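(* Let $\rho_{\bar i}(t)\in\mathcal A_{\bar i}^X$ be a TPS-invariant trajectory for some interval $[t_0,t_1]$. Choose any permissible prescription of effective Hamiltonians and apply it to both $H_{\bar j}$ in $R_j$-perspective and to the imported Hamiltonian $H_{j\to i}$ in $R_i$-perspective ($i\neq j$) for defining the energetics. Then, over $[t_0,t_1]$, the heat flow into and work done on $S$ are equal in both perspectives relative to this prescription. This is independent of whether work and heat are defined via $(\dot w,\dot q)$ or via $(\dot W,\dot Q)$. That is, for any $t\in[t_0,t_1]$, $$\dot q_{S|R_j}=\dot q_{S|R_i},\qquad \dot w_{S|R_j}=\dot w_{S|R_i},\qquad \dot E^*_{S|R_j}=\dot E^*_{S|R_i},$$ and similarly for the "other frame" subsystem $$\dot q_i=\dot q_j,\qquad \dot w_i=\dot w_j,\qquad \dot E^*_i=\dot E^*_j.$$ This holds for any frame orientations $g_i,g_j$ before and after the frame change, respectively.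
   Context: Setting. $\mathcal G$ is a finite abelian group, $\mathcal G\neq\{e\}$. For $i=1,2$ (two ideal quantum reference frames $R_1,R_2$), $\mathcal H_i=\ell^2(\mathcal G)$ has orthonormal basis $\{|g\rangle_i\}_{g\in\mathcal G}$. $\mathcal H_S$ is a finite-dimensional complex Hilbert space carrying a unitary representation $g\mapsto U_S^g$. For $i\neq j$, $\mathcal H_{\bar i}=\mathcal H_j\otimes\mathcal H_S$ and $\mathcal A_{\bar i}=\mathcal L(\mathcal H_{\bar i})$. For a unitary $W$: $\hat W(A)=WAW^\dagger$, $\hat W^\dagger(A)=W^\dagger AW$. Frame change: $V_{i\to j}^{g_i,g_j}=\sum_g|gg_i\rangle_i\otimes\langle g_jg^{-1}|_j\otimes U_S^g:\mathcal H_{\bar i}\to\mathcal H_{\bar j}$. Frame swap: $\mathcal I_{j\to i}=\sum_g|g\rangle_j\otimes\langle g|_i\otimes\mathbf 1_S:\mathcal H_{\bar j}\to\mathcal H_{\bar i}$. $\mathbf U_{\bar i}^{g_i,g_j}=\mathcal I_{j\to i}V_{i\to j}^{g_i,g_j}=\sum_g|g_ig\rangle\langle g_jg^{-1}|_j\otimes U_S^g$. For a (time-independent) bilocal unitary $X=Y_j\otimes Z_S$, $\mathcal A_{\bar i}^X=\{f\in\mathcal A_{\bar i}:\hat{\mathbf U}_{\bar i}^{g_i,g_j}(f)=\hat X^\dagger(f)\}$. Dynamics. $H_{\bar i}$ is a self-adjoint time-independent Hamiltonian on $\mathcal H_{\bar i}$, $\rho_{\bar i}(t)$ is a density-operator solution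 of $\sqrt{-1}\,\dot\rho_{\bar i}=[H_{\bar i},\rho_{\bar i}]$; $H_{\bar j}=\hat V_{i\to j}^{g_i,g_j}(H_{\bar i})$, $\rho_{\bar j}(t)=\hat V_{i\to j}^{g_i,g_j}(\rho_{\bar i}(t))$; the imported Hamiltonian is $H_{j\to i}=\hat X\hat{\mathcal I}_{j\to i}(H_{\bar j})$ on $\mathcal H_{\bar i}$. Reduced states: $\rho_{S|R_i}=\mathrm{Tr}_j\rho_{\bar i}$, $\rho_j=\mathrm{Tr}_S\rho_{\bar i}$, and likewise $\rho_{S|R_j}=\mathrm{Tr}_i\rho_{\bar j}$, $\rho_i=\mathrm{Tr}_S\rho_{\bar j}$. Bare contributions. A Hamiltonian $H$ on $\mathcal H_{\bar i}$ is written $H=H_j\otimes\mathbf 1_S+\mathbf 1_j\otimes H_{S|R_i}+H_{jS}$ with $H_{jS}$ fully non-local; for $H_{j\to i}$ this decomposition is the image under $\hat X\hat{\mathcal I}_{j\to i}$ of the one $H_{\bar j}=H_i\otimes\mathbf 1_S+\mathbf 1_i\otimes H_{S|R_j}+H_{iS}$. Put $\tilde H_{S|R_i}(t)=\mathrm{Tr}_j(H_{jS}(\rho_j(t)\otimes\mathbf 1_S))$ and analogously $\tilde H_j(t)=\mathrm{Tr}_S(H_{jS}(\mathbf 1_j\otimes\rho_{S|R_i}(t)))$; similarly in $R_j$-perspective. Permissible prescription. A rule which, in a given perspective (say $R_i$), assigns to a Hamiltonian with its bare contributions and to the global state effective Hamiltonians $H_j^{\rm eff}$, $H_{S|R_i}^{\rm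 eff}$, $H_{jS}^{\rm eff}$ (in general time-dependent through the state) such that (a) they are built linearly from the bare contributions and the global state (traces, and projections defined in terms of Hamiltonian and state, are allowed); (b) $H_j^{\rm eff}\otimes\mathbf 1_S+\mathbf 1_j\otimes H_{S|R_i}^{\rm eff}+H_{jS}^{\rm eff}$ equals the total Hamiltonian; (c) they are covariant under local basis changes: replacing Hamiltonian and state by their conjugates under $X'=Y'_j\otimes Z'_S$ replaces $H_{S|R_i}^{\rm eff},H_j^{\rm eff},H_{jS}^{\rm eff}$ by $\hat Z'_S(H_{S|R_i}^{\rm eff}),\hat Y'_j(H_j^{\rm eff}),\hat X'(H_{jS}^{\rm eff})$. The same rule is used in both perspectives, $\mathcal H_i$ and $\mathcal H_j$ being identified by the frame swap. Energetics of $S$ in $R_i$-perspective (using the Hamiltonian indicated in the claim for each perspective): $\dot w_{S|R_i}=\mathrm{Tr}(\dot H_{S|R_i}^{\rm eff}\rho_{S|R_i})$, $\dot q_{S|R_i}=\mathrm{Tr}(H_{S|R_i}^{\rm eff}\dot\rho_{S|R_i})$, $\dot E^*_{S|R_i}=-\sqrt{-1}\,\mathrm{Tr}\bigl(H_{S|R_i}^{\rm eff}[H_{S|R_i}+\tilde H_{S|R_i},\rho_{S|R_i}]\bigr)$, $\dot W_{S|R_i}=\dot w_{S|R_i}+\dot E^*_{S|R_i}$, $\dot Q_{S|R_i}=\dot q_{S|R_i}-\dot E^*_{S|R_i}$; the quantities $\dot w_j,\dot q_j,\dot E_j^*$ of the other frame $R_j$ are defined analogously with $H_j^{\rm eff},H_j,\tilde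 H_j,\rho_j$. In $R_j$-perspective exchange the labels $i$ and $j$. *)

theory Defs
  imports "HOL-Analysis.Analysis"
begin

text \<open>
  A finite-dimensional Hilbert space with a chosen orthonormal basis indexed by \<open>'n\<close> is
  \<^typ>\<open>complex^'n\<close>, and \<^typ>\<open>complex^'n^'n\<close> is its operator algebra.  The basis of
  \<open>\<H>\<^sub>f \<otimes> \<H>\<^sub>s\<close> is indexed by pairs; the frame factor always comes first.
\<close>

definition dagger :: "complex^'n^'m \<Rightarrow> complex^'m^'n" where
  "dagger A = (\<chi> i j. cnj (A $ j $ i))"

definition unitary_op :: "complex^'n^'n \<Rightarrow> bool" where
  "unitary_op W \<longleftrightarrow> W ** dagger W = mat 1 \<and> dagger W ** W = mat 1"

definition hermitian :: "complex^'n^'n \<Rightarrow> bool" where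
  "hermitian A \<longleftrightarrow> dagger A = A"

definition density_op :: "complex^'n^'n \<Rightarrow> bool" where
  "density_op A \<longleftrightarrow>
     hermitian A \<and> (\<forall>v. 0 \<le> Re (\<Sum>i\<in>UNIV. cnj (v $ i) * (A *v v) $ i)) \<and> trace A = 1"

definition conjugate :: "complex^'n^'n \<Rightarrow> complex^'n^'n \<Rightarrow> complex^'n^'n" where
  "conjugate W A = W ** A ** dagger W"

definition commutator :: "complex^'n^'n \<Rightarrow> complex^'n^'n \<Rightarrow> complex^'n^'n" where
  "commutator A B = A ** B - B ** A"

definition tensor_op ::
  "complex^'f^'f \<Rightarrow> complex^'s^'s \<Rightarrow> complex^('f \<times> 's)^('f \<times> 's)"  (infixr "\<otimes>\<^sub>o" 75) where
  "A \<otimes>\<^sub>o B = (\<chi> p q. A $ fst p $ fst q * B $ snd p $ snd q)"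

definition trace_frame :: "complex^('f::finite \<times> 's::finite)^('f \<times> 's) \<Rightarrow> complex^'s^'s" where
  "trace_frame M = (\<chi> k l. \<Sum>i\<in>UNIV. M $ (i, k) $ (i, l))"

definition trace_sys :: "complex^('f::finite \<times> 's::finite)^('f \<times> 's) \<Rightarrow> complex^'f^'f" where
  "trace_sys M = (\<chi> i j. \<Sum>k\<in>UNIV. M $ (i, k) $ (j, k))"

definition ketbra :: "'n::finite \<Rightarrow> 'n \<Rightarrow> complex^'n^'n" where
  "ketbra g h = (\<chi> a b. if a = g \<and> b = h then 1 else 0)"


text \<open>
  The finite abelian group is a type of class \<^class>\<open>ab_group_add\<close>, so the group product
  \<open>g h\<close> is written \<open>g + h\<close> and \<open>h g\<inverse>\<close> is written \<open>h - g\<close>.  Both frames live on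
  \<open>\<ell>\<^sup>2(\<G>)\<close>, so in either perspective the kinematical space is indexed by \<open>'g \<times> 's\<close>, where
  \<open>'g\<close> refers to the other frame.
\<close>

definition unitary_rep :: "('g::{ab_group_add,finite} \<Rightarrow> complex^'s^'s) \<Rightarrow> bool" where
  "unitary_rep U \<longleftrightarrow>
     (\<forall>g. unitary_op (U g)) \<and> U 0 = mat 1 \<and> (\<forall>g h. U (g + h) = U g ** U h)"

definition frame_change ::
  "('g::{ab_group_add,finite} \<Rightarrow> complex^'s^'s) \<Rightarrow> 'g \<Rightarrow> 'g \<Rightarrow> complex^('g \<times> 's)^('g \<times> 's)" where
  "frame_change U gi gj = (\<Sum>g\<in>UNIV. ketbra (g + gi) (gj - g) \<otimes>\<^sub>o U g)"

definition relabel_frame :: "complex^'g^'g" where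
  "relabel_frame = (\<Sum>g\<in>UNIV. ketbra g g)"

definition frame_swap :: "complex^('g::finite \<times> 's::finite)^('g \<times> 's)" where
  "frame_swap = relabel_frame \<otimes>\<^sub>o mat 1"

definition TPS_invariant_algebra ::
  "('g::{ab_group_add,finite} \<Rightarrow> complex^'s^'s) \<Rightarrow> 'g \<Rightarrow> 'g
     \<Rightarrow> complex^('g::{ab_group_add,finite})^('g::{ab_group_add,finite}) \<Rightarrow> complex^'s^'s
     \<Rightarrow> (complex^('g \<times> 's)^('g \<times> 's)) set" where
  "TPS_invariant_algebra U gi gj Y Z =
     {f. conjugate (frame_swap ** frame_change U gi gj) f = conjugate (dagger (Y \<otimes>\<^sub>o Z)) f}"

definition von_neumann_solution ::
  "complex^'n^'n \<Rightarrow> (real \<Rightarrow> complex^'n^'n) \<Rightarrow> real set \<Rightarrow> bool" where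
  "von_neumann_solution H \<rho> T \<longleftrightarrow>
     (\<forall>t\<in>T. \<exists>\<rho>'. (\<rho> has_vector_derivative \<rho>') (at t within T) \<and>
            mat \<i> ** \<rho>' = commutator H (\<rho> t))"


text \<open>
  The same record carries the bare contributions of a Hamiltonian and the effective
  Hamiltonians that a prescription returns.
\<close>

record ('f, 's) ham_parts =
  frame_part :: "complex^'f^'f"
  sys_part :: "complex^'s^'s"
  int_part :: "complex^('f::finite \<times> 's::finite)^('f \<times> 's)"

definition total_ham :: "('f::finite, 's::finite) ham_parts \<Rightarrow> complex^('f \<times> 's)^('f \<times> 's)" where
  "total_ham D = frame_part D \<otimes>\<^sub>o mat 1 + mat 1 \<otimes>\<^sub>o sys_part D + int_part D"

text \<open>
  The partial traces of \<open>C\<close> vanish iff \<open>C\<close> is Hilbert-Schmidt orthogonal to every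
  \<open>A \<otimes> 1 + 1 \<otimes> B\<close>, that is, iff \<open>C\<close> has no local component.
\<close>

definition fully_nonlocal :: "complex^('f::finite \<times> 's::finite)^('f \<times> 's) \<Rightarrow> bool" where
  "fully_nonlocal C \<longleftrightarrow> trace_frame C = 0 \<and> trace_sys C = 0"

text \<open>
  The local parts of a Hamiltonian are unique only up to moving a multiple of the identity
  between them, so the decomposition is a relation and not a function of the Hamiltonian.
\<close>

definition bare_contributions :: "('f::finite, 's::finite) ham_parts \<Rightarrow> bool" where
  "bare_contributions D \<longleftrightarrow>
     hermitian (frame_part D) \<and> hermitian (sys_part D) \<and> hermitian (int_part D) \<and>
     fully_nonlocal (int_part D)"

definition bare_contributions_of ::
  "complex^('f::finite \<times> 's::finite)^('f \<times> 's) \<Rightarrow> ('f, 's) ham_parts \<Rightarrow> bool" where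
  "bare_contributions_of H D \<longleftrightarrow> bare_contributions D \<and> H = total_ham D"

definition conj_parts ::
  "complex^'f^'f \<Rightarrow> complex^'s^'s \<Rightarrow> ('f::finite, 's::finite) ham_parts \<Rightarrow> ('f, 's) ham_parts" where
  "conj_parts Y Z D =
     \<lparr>frame_part = conjugate Y (frame_part D),
      sys_part = conjugate Z (sys_part D),
      int_part = conjugate (Y \<otimes>\<^sub>o Z) (int_part D)\<rparr>"

definition imported_ham ::
  "complex^'g^'g \<Rightarrow> complex^'s^'s \<Rightarrow> complex^('g::finite \<times> 's::finite)^('g \<times> 's)
     \<Rightarrow> complex^('g \<times> 's)^('g \<times> 's)" where
  "imported_ham Y Z H = conjugate (Y \<otimes>\<^sub>o Z) (conjugate frame_swap H)"

definition imported_parts ::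
  "complex^'g^'g \<Rightarrow> complex^'s^'s \<Rightarrow> ('g::finite, 's::finite) ham_parts \<Rightarrow> ('g, 's) ham_parts" where
  "imported_parts Y Z D = conj_parts Y Z (conj_parts relabel_frame (mat 1) D)"


text \<open>
  Being built linearly from the bare contributions and the global state is expressed as an
  inductive closure.  Local operators \<open>A\<close>, \<open>B\<close> are represented by \<open>A \<otimes> 1\<close>, \<open>1 \<otimes> B\<close>.  Traces
  may be taken against the global state or its marginals, which covers for instance
  \<open>Tr\<^sub>j (H\<^sub>j\<^sub>S (\<rho>\<^sub>j \<otimes> 1))\<close>.  A projection is any idempotent real-linear map on operators, and
  it may depend arbitrarily on the Hamiltonian and the state; the dependence on the
  Hamiltonian is through its bare contributions.
\<close>

inductive state_weight ::
  "(complex^('f::finite \<times> 's::finite)^('f \<times> 's) \<Rightarrow> complex^('f \<times> 's)^('f \<times> 's)) \<Rightarrow> bool" where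
  one: "state_weight (\<lambda>\<rho>. mat 1)"
| global: "state_weight (\<lambda>\<rho>. \<rho>)"
| frame: "state_weight (\<lambda>\<rho>. trace_sys \<rho> \<otimes>\<^sub>o mat 1)"
| sys: "state_weight (\<lambda>\<rho>. mat 1 \<otimes>\<^sub>o trace_frame \<rho>)"

inductive linearly_built ::
  "(('f::finite, 's::finite) ham_parts \<Rightarrow> complex^('f \<times> 's)^('f \<times> 's)
     \<Rightarrow> complex^('f \<times> 's)^('f \<times> 's)) \<Rightarrow> bool" where
  bare_frame: "linearly_built (\<lambda>D \<rho>. frame_part D \<otimes>\<^sub>o mat 1)"
| bare_sys: "linearly_built (\<lambda>D \<rho>. mat 1 \<otimes>\<^sub>o sys_part D)"
| bare_int: "linearly_built (\<lambda>D \<rho>. int_part D)"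
| state: "linearly_built (\<lambda>D \<rho>. \<rho>)"
| add: "linearly_built F \<Longrightarrow> linearly_built G \<Longrightarrow> linearly_built (\<lambda>D \<rho>. F D \<rho> + G D \<rho>)"
| scale: "linearly_built F \<Longrightarrow> linearly_built (\<lambda>D \<rho>. mat c ** F D \<rho>)"
| trace_frame: "linearly_built F \<Longrightarrow> state_weight \<sigma> \<Longrightarrow> state_weight \<tau> \<Longrightarrow>
    linearly_built (\<lambda>D \<rho>. mat 1 \<otimes>\<^sub>o trace_frame (\<sigma> \<rho> ** F D \<rho> ** \<tau> \<rho>))"
| trace_sys: "linearly_built F \<Longrightarrow> state_weight \<sigma> \<Longrightarrow> state_weight \<tau> \<Longrightarrow>
    linearly_built (\<lambda>D \<rho>. trace_sys (\<sigma> \<rho> ** F D \<rho> ** \<tau> \<rho>) \<otimes>\<^sub>o mat 1)"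
| projection: "linearly_built F \<Longrightarrow> (\<And>D \<rho>. linear (P D \<rho>)) \<Longrightarrow>
    (\<And>D \<rho> A. P D \<rho> (P D \<rho> A) = P D \<rho> A) \<Longrightarrow> linearly_built (\<lambda>D \<rho>. P D \<rho> (F D \<rho>))"

type_synonym ('f, 's) prescription =
  "('f, 's) ham_parts \<Rightarrow> complex^('f \<times> 's)^('f \<times> 's) \<Rightarrow> ('f, 's) ham_parts"

definition agrees_on_physical ::
  "(('f::finite, 's::finite) ham_parts \<Rightarrow> complex^('f \<times> 's)^('f \<times> 's) \<Rightarrow> 'a)
     \<Rightarrow> (('f, 's) ham_parts \<Rightarrow> complex^('f \<times> 's)^('f \<times> 's) \<Rightarrow> 'a) \<Rightarrow> bool" where
  "agrees_on_physical F G \<longleftrightarrow>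
     (\<forall>D \<rho>. bare_contributions D \<longrightarrow> density_op \<rho> \<longrightarrow> F D \<rho> = G D \<rho>)"

definition permissible :: "('f::finite, 's::finite) prescription \<Rightarrow> bool" where
  "permissible R \<longleftrightarrow>
     (\<exists>F. linearly_built F \<and> agrees_on_physical (\<lambda>D \<rho>. frame_part (R D \<rho>) \<otimes>\<^sub>o mat 1) F) \<and>
     (\<exists>F. linearly_built F \<and> agrees_on_physical (\<lambda>D \<rho>. mat 1 \<otimes>\<^sub>o sys_part (R D \<rho>)) F) \<and>
     (\<exists>F. linearly_built F \<and> agrees_on_physical (\<lambda>D \<rho>. int_part (R D \<rho>)) F) \<and>
     agrees_on_physical (\<lambda>D \<rho>. total_ham (R D \<rho>)) (\<lambda>D \<rho>. total_ham D) \<and>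
     (\<forall>Y Z. unitary_op Y \<longrightarrow> unitary_op Z \<longrightarrow>
        agrees_on_physical
          (\<lambda>D \<rho>. R (conj_parts Y Z D) (conjugate (Y \<otimes>\<^sub>o Z) \<rho>))
          (\<lambda>D \<rho>. conj_parts Y Z (R D \<rho>)))"


definition induced_sys ::
  "('f::finite, 's::finite) ham_parts \<Rightarrow> complex^('f \<times> 's)^('f \<times> 's) \<Rightarrow> complex^'s^'s" where
  "induced_sys D \<rho> = trace_frame (int_part D ** (trace_sys \<rho> \<otimes>\<^sub>o mat 1))"

definition induced_frame ::
  "('f::finite, 's::finite) ham_parts \<Rightarrow> complex^('f \<times> 's)^('f \<times> 's) \<Rightarrow> complex^'f^'f" where
  "induced_frame D \<rho> = trace_sys (int_part D ** (mat 1 \<otimes>\<^sub>o trace_frame \<rho>))"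

text \<open>
  Time derivatives are taken within the interval \<open>T\<close>, so they are one-sided at its end points.
  The rates below depend on the prescription \<open>R\<close>, the bare contributions \<open>D\<close>, the global
  trajectory \<open>\<rho>\<close>, the interval and the time, in this order.
\<close>

type_synonym ('f, 's) rate =
  "('f, 's) prescription \<Rightarrow> ('f, 's) ham_parts \<Rightarrow> (real \<Rightarrow> complex^('f \<times> 's)^('f \<times> 's))
     \<Rightarrow> real set \<Rightarrow> real \<Rightarrow> complex"

definition w_rate_sys :: "('f::finite, 's::finite) rate" where
  "w_rate_sys R D \<rho> T t =
     trace (vector_derivative (\<lambda>\<tau>. sys_part (R D (\<rho> \<tau>))) (at t within T) ** trace_frame (\<rho> t))"

definition q_rate_sys :: "('f::finite, 's::finite) rate" where
  "q_rate_sys R D \<rho> T t =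
     trace (sys_part (R D (\<rho> t)) ** vector_derivative (\<lambda>\<tau>. trace_frame (\<rho> \<tau>)) (at t within T))"

definition E_rate_sys :: "('f::finite, 's::finite) rate" where
  "E_rate_sys R D \<rho> T t =
     - \<i> * trace (sys_part (R D (\<rho> t)) **
                  commutator (sys_part D + induced_sys D (\<rho> t)) (trace_frame (\<rho> t)))"

definition W_rate_sys :: "('f::finite, 's::finite) rate" where
  "W_rate_sys R D \<rho> T t = w_rate_sys R D \<rho> T t + E_rate_sys R D \<rho> T t"

definition Q_rate_sys :: "('f::finite, 's::finite) rate" where
  "Q_rate_sys R D \<rho> T t = q_rate_sys R D \<rho> T t - E_rate_sys R D \<rho> T t"

definition w_rate_frame :: "('f::finite, 's::finite) rate" where
  "w_rate_frame R D \<rho> T t =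
     trace (vector_derivative (\<lambda>\<tau>. frame_part (R D (\<rho> \<tau>))) (at t within T) ** trace_sys (\<rho> t))"

definition q_rate_frame :: "('f::finite, 's::finite) rate" where
  "q_rate_frame R D \<rho> T t =
     trace (frame_part (R D (\<rho> t)) ** vector_derivative (\<lambda>\<tau>. trace_sys (\<rho> \<tau>)) (at t within T))"

definition E_rate_frame :: "('f::finite, 's::finite) rate" where
  "E_rate_frame R D \<rho> T t =
     - \<i> * trace (frame_part (R D (\<rho> t)) **
                  commutator (frame_part D + induced_frame D (\<rho> t)) (trace_sys (\<rho> t)))"

definition W_rate_frame :: "('f::finite, 's::finite) rate" where
  "W_rate_frame R D \<rho> T t = w_rate_frame R D \<rho> T t + E_rate_frame R D \<rho> T t"

definition Q_rate_frame :: "('f::finite, 's::finite) rate" where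
  "Q_rate_frame R D \<rho> T t = q_rate_frame R D \<rho> T t - E_rate_frame R D \<rho> T t"

text \<open>
  A prescription need not depend differentiably on the state.  The rates \<open>w\<close> and \<open>W\<close> are
  meaningful at \<open>t\<close> only where the respective effective Hamiltonian is differentiable.
\<close>

definition w_sys_defined ::
  "('f::finite, 's::finite) prescription \<Rightarrow> ('f, 's) ham_parts
     \<Rightarrow> (real \<Rightarrow> complex^('f \<times> 's)^('f \<times> 's)) \<Rightarrow> real set \<Rightarrow> real \<Rightarrow> bool" where
  "w_sys_defined R D \<rho> T t \<longleftrightarrow> (\<lambda>\<tau>. sys_part (R D (\<rho> \<tau>))) differentiable (at t within T)"

definition w_frame_defined ::
  "('f::finite, 's::finite) prescription \<Rightarrow> ('f, 's) ham_parts
     \<Rightarrow> (real \<Rightarrow> complex^('f \<times> 's)^('f \<times> 's)) \<Rightarrow> real set \<Rightarrow> real \<Rightarrow> bool" where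
  "w_frame_defined R D \<rho> T t \<longleftrightarrow> (\<lambda>\<tau>. frame_part (R D (\<rho> \<tau>))) differentiable (at t within T)"

end

(*
  Both frames live on the same space, so the frame swap is the identity.  For a TPS-invariant
  trajectory the frame change therefore acts as conjugation by the bilocal unitary
  X^dagger = Y^dagger (x) Z^dagger, and the same conjugation takes the bare contributions of the
  imported Hamiltonian to those of H_j.  Covariance carries this over to the effective
  Hamiltonians, and every rate is a trace, hence unchanged by a local change of basis.
*)

theory Submission
  imports Defs
begin

section \<open>Adjoints and conjugation\<close>

lemma dagger_mult: "dagger (A ** B) = dagger B ** dagger A"
  for A :: "complex^'n^'m" and B :: "complex^'k^'n"
  by (simp add: dagger_def matrix_matrix_mult_def vec_eq_iff mult.commute)

lemma dagger_dagger [simp]: "dagger (dagger A) = A"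
  by (simp add: dagger_def vec_eq_iff)

lemma dagger_mat_1 [simp]: "dagger (mat 1) = mat 1"
  by (simp add: dagger_def mat_def vec_eq_iff)

lemma unitary_op_dagger: "unitary_op W \<Longrightarrow> unitary_op (dagger W)"
  by (simp add: unitary_op_def)

lemma conjugate_conjugate: "conjugate V (conjugate W A) = conjugate (V ** W) A"
  by (simp add: conjugate_def dagger_mult matrix_mul_assoc)

lemma conjugate_mat_1 [simp]: "conjugate (mat 1) A = A"
  by (simp add: conjugate_def)

lemma conjugate_dagger_cancel: "unitary_op W \<Longrightarrow> conjugate (dagger W) (conjugate W A) = A"
  by (simp add: conjugate_conjugate unitary_op_def)

lemma conjugate_one: "unitary_op W \<Longrightarrow> conjugate W (mat 1) = mat 1"
  by (simp add: conjugate_def unitary_op_def)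

lemma conjugate_0 [simp]: "conjugate W 0 = 0"
  by (simp add: conjugate_def)

lemma conjugate_add: "conjugate W (A + B) = conjugate W A + conjugate W B"
  by (simp add: conjugate_def matrix_matrix_mult_def vec_eq_iff algebra_simps sum.distrib)

lemma conjugate_diff: "conjugate W (A - B) = conjugate W A - conjugate W B"
  by (metis add_diff_cancel_right' conjugate_add diff_add_cancel)

lemma conjugate_mult:
  assumes "unitary_op W"
  shows "conjugate W A ** conjugate W B = conjugate W (A ** B)"
proof -
  have "conjugate W A ** conjugate W B = W ** A ** (dagger W ** W) ** B ** dagger W"
    by (simp add: conjugate_def matrix_mul_assoc)
  then show ?thesis
    using assms by (simp add: conjugate_def unitary_op_def) (simp add: matrix_mul_assoc)
qed

lemma conjugate_commutator:
  "unitary_op W \<Longrightarrow>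
     commutator (conjugate W A) (conjugate W B) = conjugate W (commutator A B)"
  by (simp add: commutator_def conjugate_mult conjugate_diff)

text \<open>Cyclicity of the trace. With \<open>conjugate_mult\<close> it makes the trace of a
  product of conjugated operators invariant, the form of every rate.\<close>

lemma trace_conjugate: "unitary_op W \<Longrightarrow> trace (conjugate W A) = trace A"
  by (metis conjugate_def matrix_mul_assoc matrix_mul_lid trace_mul_sym unitary_op_def)

lemma hermitian_conjugate: "hermitian A \<Longrightarrow> hermitian (conjugate W A)"
  by (simp add: hermitian_def conjugate_def dagger_mult matrix_mul_assoc)

text \<open>Real linearity is the form needed for curves in a real time parameter; finite dimension
  then gives boundedness.\<close>

lemma linear_conjugate: "linear (conjugate W)"
proof (rule linearI)
  show "conjugate W (c *\<^sub>R A) = c *\<^sub>R conjugate W A" for c A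
    by (simp add: conjugate_def matrix_matrix_mult_def vec_eq_iff scaleR_right.sum
        sum_distrib_left sum_distrib_right)
qed (rule conjugate_add)


section \<open>Tensor products and partial traces\<close>

lemma dagger_tensor_op: "dagger (A \<otimes>\<^sub>o B) = dagger A \<otimes>\<^sub>o dagger B"
  by (simp add: dagger_def tensor_op_def vec_eq_iff)

lemma sum_UNIV_prod: "(\<Sum>p\<in>UNIV. f p) = (\<Sum>i\<in>UNIV. \<Sum>k\<in>UNIV. f (i, k))"
  for f :: "'a::finite \<times> 'b::finite \<Rightarrow> complex"
  unfolding UNIV_Times_UNIV [symmetric] by (simp add: sum.cartesian_product del: UNIV_Times_UNIV)

lemma tensor_op_mult: "(A \<otimes>\<^sub>o B) ** (C \<otimes>\<^sub>o D) = (A ** C) \<otimes>\<^sub>o (B ** D)"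
  by (simp add: tensor_op_def matrix_matrix_mult_def vec_eq_iff sum_UNIV_prod sum_product
      mult_ac)

lemma tensor_op_mat_1 [simp]: "mat 1 \<otimes>\<^sub>o mat 1 = mat 1"
  by (auto simp: tensor_op_def mat_def vec_eq_iff)

lemma unitary_op_tensor: "unitary_op Y \<Longrightarrow> unitary_op Z \<Longrightarrow> unitary_op (Y \<otimes>\<^sub>o Z)"
  by (simp add: unitary_op_def dagger_tensor_op tensor_op_mult)

lemma conjugate_tensor_op: "conjugate (Y \<otimes>\<^sub>o Z) (A \<otimes>\<^sub>o B) = conjugate Y A \<otimes>\<^sub>o conjugate Z B"
  by (simp add: conjugate_def dagger_tensor_op tensor_op_mult)

section \<open>Partial traces and multiplication by local operators\<close>

lemma sum_mat_1_left: "(\<Sum>j\<in>UNIV. mat 1 $ i $ j * f j) = f i"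
  for f :: "'n::finite \<Rightarrow> complex"
  by (simp add: mat_def if_distrib [where f = "\<lambda>x. x * _"] cong: if_cong)

lemma sum_mat_1_right: "(\<Sum>j\<in>UNIV. f j * mat 1 $ j $ i) = f i"
  for f :: "'n::finite \<Rightarrow> complex"
  by (simp add: mat_def if_distrib cong: if_cong)

lemma trace_frame_sys_left: "trace_frame ((mat 1 \<otimes>\<^sub>o B) ** M) = B ** trace_frame M"
proof -
  have "(\<Sum>i\<in>UNIV. \<Sum>j\<in>UNIV. \<Sum>m\<in>UNIV. mat 1 $ i $ j * B $ k $ m * M $ (j, m) $ (i, l))
      = (\<Sum>m\<in>UNIV. B $ k $ m * (\<Sum>i\<in>UNIV. M $ (i, m) $ (i, l)))" for k l
  proof -
    have "(\<Sum>i\<in>UNIV. \<Sum>j\<in>UNIV. \<Sum>m\<in>UNIV. mat 1 $ i $ j * B $ k $ m * M $ (j, m) $ (i, l))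
        = (\<Sum>i\<in>UNIV. \<Sum>j\<in>UNIV. mat 1 $ i $ j * (\<Sum>m\<in>UNIV. B $ k $ m * M $ (j, m) $ (i, l)))"
      by (simp add: sum_distrib_left mult.assoc)
    also have "\<dots> = (\<Sum>i\<in>UNIV. \<Sum>m\<in>UNIV. B $ k $ m * M $ (i, m) $ (i, l))"
      by (simp add: sum_mat_1_left)
    also have "\<dots> = (\<Sum>m\<in>UNIV. B $ k $ m * (\<Sum>i\<in>UNIV. M $ (i, m) $ (i, l)))"
      by (subst sum.swap) (simp add: sum_distrib_left)
    finally show ?thesis .
  qed
  then show ?thesis
    by (simp add: trace_frame_def tensor_op_def matrix_matrix_mult_def vec_eq_iff sum_UNIV_prod)
qed

lemma dagger_trace_frame: "dagger (trace_frame M) = trace_frame (dagger M)"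
  by (simp add: dagger_def trace_frame_def vec_eq_iff)

text \<open>Adjoints turn right multiplication into left multiplication, which avoids a second index
  computation.\<close>

lemma trace_frame_sys_right: "trace_frame (M ** (mat 1 \<otimes>\<^sub>o B)) = trace_frame M ** B"
proof -
  have "trace_frame (M ** (mat 1 \<otimes>\<^sub>o B)) = dagger (trace_frame ((mat 1 \<otimes>\<^sub>o dagger B) ** dagger M))"
    by (simp add: dagger_trace_frame dagger_mult dagger_tensor_op)
  then show ?thesis
    by (simp add: trace_frame_sys_left dagger_mult dagger_trace_frame)
qed

text \<open>A partial trace is not cyclic in general, but it is for an operator on the factor traced
  out: both sides become double sums over frame indices that differ by interchanging the
  sums.\<close>

lemma trace_frame_cyclic: "trace_frame ((A \<otimes>\<^sub>o mat 1) ** M) = trace_frame (M ** (A \<otimes>\<^sub>o mat 1))"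
proof -
  have "(\<Sum>i\<in>UNIV. \<Sum>j\<in>UNIV. \<Sum>m\<in>UNIV. A $ i $ j * mat 1 $ k $ m * M $ (j, m) $ (i, l))
      = (\<Sum>i\<in>UNIV. \<Sum>j\<in>UNIV. A $ i $ j * M $ (j, k) $ (i, l))" for k l
    by (simp only: sum_mat_1_left mult.assoc sum_distrib_left [symmetric])
  moreover
  have "(\<Sum>i\<in>UNIV. \<Sum>j\<in>UNIV. \<Sum>m\<in>UNIV. M $ (i, k) $ (j, m) * (A $ j $ i * mat 1 $ m $ l))
      = (\<Sum>i\<in>UNIV. \<Sum>j\<in>UNIV. A $ j $ i * M $ (i, k) $ (j, l))" for k l
    by (simp only: sum_mat_1_right mult.assoc [symmetric]) (simp only: mult.commute)
  moreover
  have "(\<Sum>i\<in>UNIV. \<Sum>j\<in>UNIV. A $ i $ j * M $ (j, k) $ (i, l))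
      = (\<Sum>i\<in>UNIV. \<Sum>j\<in>UNIV. A $ j $ i * M $ (i, k) $ (j, l))" for k l
    by (rule sum.swap)
  ultimately show ?thesis
    by (simp add: trace_frame_def tensor_op_def matrix_matrix_mult_def vec_eq_iff sum_UNIV_prod)
qed

text \<open>Split the bilocal operator into a frame and a system factor. The former cancels by
  partial cyclicity and unitarity of \<open>Y\<close>; the latter moves out of the trace.\<close>

lemma trace_frame_conjugate:
  assumes "unitary_op Y"
  shows "trace_frame (conjugate (Y \<otimes>\<^sub>o Z) M) = conjugate Z (trace_frame M)"
proof -
  have "conjugate (Y \<otimes>\<^sub>o Z) M
      = (mat 1 \<otimes>\<^sub>o Z) ** ((Y \<otimes>\<^sub>o mat 1) ** M ** (dagger Y \<otimes>\<^sub>o mat 1)) ** (mat 1 \<otimes>\<^sub>o dagger Z)"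
    \<comment> \<open>Left-nested products merge the tensor factors to the left of \<open>M\<close>;
      reassociating to the right then merges those to its right.\<close>
    by (simp add: conjugate_def dagger_tensor_op matrix_mul_assoc tensor_op_mult)
       (simp add: tensor_op_mult flip: matrix_mul_assoc)
  moreover have "trace_frame ((Y \<otimes>\<^sub>o mat 1) ** M ** (dagger Y \<otimes>\<^sub>o mat 1)) = trace_frame M"
    using assms
    by (simp add: trace_frame_cyclic tensor_op_mult unitary_op_def flip: matrix_mul_assoc)
  ultimately show ?thesis
    by (simp only: trace_frame_sys_left trace_frame_sys_right conjugate_def)
qed

text \<open>Conjugation by the unitary exchanging the factors, encoded as an index permutation. It
  transfers results on \<open>trace_frame\<close> to \<open>trace_sys\<close>.\<close>

definition flip_factors ::
  "complex^('f::finite \<times> 's::finite)^('f \<times> 's) \<Rightarrow> complex^('s \<times> 'f)^('s \<times> 'f)" where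
  "flip_factors M = (\<chi> p q. M $ prod.swap p $ prod.swap q)"

lemma flip_factors_mult: "flip_factors (M ** N) = flip_factors M ** flip_factors N"
proof -
  have "(\<Sum>r\<in>UNIV. M $ p $ r * N $ r $ q)
      = (\<Sum>r\<in>UNIV. M $ p $ prod.swap r * N $ prod.swap r $ q)" for p q
    using sum.reindex_bij_betw [OF bij_swap, of "\<lambda>r. M $ p $ r * N $ r $ q"] by simp
  then show ?thesis
    by (simp add: flip_factors_def matrix_matrix_mult_def vec_eq_iff)
qed

lemma flip_factors_tensor_op: "flip_factors (A \<otimes>\<^sub>o B) = B \<otimes>\<^sub>o A"
  by (simp add: flip_factors_def tensor_op_def vec_eq_iff mult.commute)

lemma dagger_flip_factors: "dagger (flip_factors M) = flip_factors (dagger M)"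
  by (simp add: dagger_def flip_factors_def vec_eq_iff)

lemma trace_sys_eq_trace_frame_flip: "trace_sys M = trace_frame (flip_factors M)"
  by (simp add: trace_sys_def trace_frame_def flip_factors_def)

lemma trace_sys_conjugate:
  assumes "unitary_op Z"
  shows "trace_sys (conjugate (Y \<otimes>\<^sub>o Z) M) = conjugate Y (trace_sys M)"
proof -
  have "flip_factors (conjugate (Y \<otimes>\<^sub>o Z) M) = conjugate (Z \<otimes>\<^sub>o Y) (flip_factors M)"
    by (simp add: conjugate_def flip_factors_mult flip_factors_tensor_op
        flip: dagger_flip_factors)
  then show ?thesis
    using assms by (simp add: trace_sys_eq_trace_frame_flip trace_frame_conjugate)
qed

lemma linear_trace_frame: "linear trace_frame"
  by (rule linearI)
     (simp_all add: trace_frame_def vec_eq_iff sum.distrib scaleR_right.sum)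

lemma linear_trace_sys: "linear trace_sys"
  by (rule linearI)
     (simp_all add: trace_sys_def vec_eq_iff sum.distrib scaleR_right.sum)


section \<open>Local changes of basis\<close>

lemma total_ham_conj_parts:
  "unitary_op Y \<Longrightarrow> unitary_op Z \<Longrightarrow>
     total_ham (conj_parts Y Z D) = conjugate (Y \<otimes>\<^sub>o Z) (total_ham D)"
  by (simp add: total_ham_def conj_parts_def conjugate_add conjugate_tensor_op conjugate_one)

text \<open>Full non-locality survives because the partial traces of the conjugated interaction are
  conjugates of zero.\<close>

lemma bare_contributions_conj_parts:
  "unitary_op Y \<Longrightarrow> unitary_op Z \<Longrightarrow> bare_contributions D \<Longrightarrow>
     bare_contributions (conj_parts Y Z D)"
  by (simp add: bare_contributions_def fully_nonlocal_def conj_parts_def hermitian_conjugate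
      trace_frame_conjugate trace_sys_conjugate)

lemma bare_contributions_of_conj_parts:
  "unitary_op Y \<Longrightarrow> unitary_op Z \<Longrightarrow> bare_contributions_of H D \<Longrightarrow>
     bare_contributions_of (conjugate (Y \<otimes>\<^sub>o Z) H) (conj_parts Y Z D)"
  by (simp add: bare_contributions_of_def bare_contributions_conj_parts total_ham_conj_parts)

lemma conj_parts_dagger_cancel:
  "unitary_op Y \<Longrightarrow> unitary_op Z \<Longrightarrow>
     conj_parts (dagger Y) (dagger Z) (conj_parts Y Z D) = D"
  by (simp add: conj_parts_def conjugate_dagger_cancel unitary_op_tensor
      flip: dagger_tensor_op)

lemma induced_sys_conj:
  assumes "unitary_op Y" "unitary_op Z"
  shows "induced_sys (conj_parts Y Z D) (conjugate (Y \<otimes>\<^sub>o Z) \<rho>) = conjugate Z (induced_sys D \<rho>)"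
proof -
  \<comment> \<open>By unitarity of \<open>Z\<close> the identity is its own conjugate, so both
    factors inside the trace are conjugated by one bilocal unitary.\<close>
  have "conjugate Y (trace_sys \<rho>) \<otimes>\<^sub>o mat 1 = conjugate (Y \<otimes>\<^sub>o Z) (trace_sys \<rho> \<otimes>\<^sub>o mat 1)"
    using assms by (simp add: conjugate_tensor_op conjugate_one)
  then show ?thesis
    using assms by (simp add: induced_sys_def conj_parts_def trace_sys_conjugate
        trace_frame_conjugate conjugate_mult unitary_op_tensor)
qed

lemma induced_frame_conj:
  assumes "unitary_op Y" "unitary_op Z"
  shows "induced_frame (conj_parts Y Z D) (conjugate (Y \<otimes>\<^sub>o Z) \<rho>) = conjugate Y (induced_frame D \<rho>)"
proof -
  have "mat 1 \<otimes>\<^sub>o conjugate Z (trace_frame \<rho>) = conjugate (Y \<otimes>\<^sub>o Z) (mat 1 \<otimes>\<^sub>o trace_frame \<rho>)"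
    using assms by (simp add: conjugate_tensor_op conjugate_one)
  then show ?thesis
    using assms by (simp add: induced_frame_def conj_parts_def trace_sys_conjugate
        trace_frame_conjugate conjugate_mult unitary_op_tensor)
qed

section \<open>Differentiation along conjugated trajectories\<close>

lemma has_vector_derivative_conjugate:
  assumes "(f has_vector_derivative f') (at t within S)"
    and "t \<in> S" "\<And>\<tau>. \<tau> \<in> S \<Longrightarrow> g \<tau> = conjugate W (f \<tau>)"
  shows "(g has_vector_derivative conjugate W f') (at t within S)"
proof -
  have "bounded_linear (conjugate W)"
    using linear_conjugate by (rule linear_conv_bounded_linear [THEN iffD1])
  from bounded_linear.has_vector_derivative [OF this assms(1)]
  show ?thesis
    \<comment> \<open>Agreement on \<open>S\<close> is enough for a derivative within
      \<open>S\<close> at a point of \<open>S\<close>; TPS invariance is known on the interval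
      only.\<close>
    using has_vector_derivative_transform [where f = "\<lambda>\<tau>. conjugate W (f \<tau>)", OF assms(2,3)]
    by simp
qed

lemma differentiable_conjugate:
  fixes f g :: "real \<Rightarrow> complex^'n^'n"
  assumes "f differentiable (at t within S)"
    and "t \<in> S" "\<And>\<tau>. \<tau> \<in> S \<Longrightarrow> g \<tau> = conjugate W (f \<tau>)"
  shows "g differentiable (at t within S)"
  using has_vector_derivative_conjugate
    [OF assms(1) [unfolded vector_derivative_works] assms(2,3)]
  by (rule differentiableI_vector)

lemma differentiable_conjugate_iff:
  fixes f g :: "real \<Rightarrow> complex^'n^'n"
  assumes "unitary_op W" "t \<in> S" "\<And>\<tau>. \<tau> \<in> S \<Longrightarrow> g \<tau> = conjugate W (f \<tau>)"
  shows "g differentiable (at t within S) \<longleftrightarrow> f differentiable (at t within S)"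
proof
  \<comment> \<open>Unitarity inverts the relation, so the converse is the same argument with
    \<open>dagger W\<close>.\<close>
  have "f \<tau> = conjugate (dagger W) (g \<tau>)" if "\<tau> \<in> S" for \<tau>
    using assms that by (simp add: conjugate_dagger_cancel)
  with _ assms(2) show "f differentiable (at t within S)" if "g differentiable (at t within S)"
    by (rule differentiable_conjugate) (rule that)
  show "g differentiable (at t within S)" if "f differentiable (at t within S)"
    using that assms(2,3) by (rule differentiable_conjugate)
qed

text \<open>\<open>vector_derivative\<close> is defined by choice; \<open>a < b\<close> makes the
  derivative within the interval unique, also at the end points.\<close>

lemma vector_derivative_conjugate:
  fixes f g :: "real \<Rightarrow> complex^'n^'n"
  assumes "a < b" "t \<in> {a..b}" "f differentiable (at t within {a..b})"
    and "\<And>\<tau>. \<tau> \<in> {a..b} \<Longrightarrow> g \<tau> = conjugate W (f \<tau>)"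
  shows "vector_derivative g (at t within {a..b})
       = conjugate W (vector_derivative f (at t within {a..b}))"
proof -
  have "(f has_vector_derivative vector_derivative f (at t within {a..b})) (at t within {a..b})"
    using assms(3) by (simp add: vector_derivative_works)
  then have "(g has_vector_derivative conjugate W (vector_derivative f (at t within {a..b})))
      (at t within {a..b})"
    using assms(2,4) by (rule has_vector_derivative_conjugate)
  then show ?thesis
    using assms(1,2) by (simp add: vector_derivative_within_closed_interval)
qed

lemma von_neumann_solution_differentiable:
  "von_neumann_solution H \<rho> S \<Longrightarrow> t \<in> S \<Longrightarrow> \<rho> differentiable (at t within S)"
  by (auto simp: von_neumann_solution_def intro: differentiableI_vector)

text \<open>Applied to the partial traces, so that reduced states inherit differentiability from the
  global state.\<close>

lemma differentiable_linear_compose: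
  fixes f :: "real \<Rightarrow> 'a::euclidean_space" and L :: "'a \<Rightarrow> 'b::real_normed_vector"
  assumes "linear L" "f differentiable (at t within S)"
  shows "(\<lambda>\<tau>. L (f \<tau>)) differentiable (at t within S)"
proof -
  have "bounded_linear L"
    using assms(1) by (rule linear_conv_bounded_linear [THEN iffD1])
  from bounded_linear.has_vector_derivative [OF this assms(2) [unfolded vector_derivative_works]]
  show ?thesis
    by (rule differentiableI_vector)
qed


section \<open>Invariance of the energetics\<close>

text \<open>One fixed local change of basis leads from the unprimed to the primed data.
  \<open>effective\<close> is covariance along the trajectory, which separates the comparison of
  rates from permissibility and from the frame change.\<close>

locale covariant_trajectory =
  fixes R :: "('f::finite, 's::finite) prescription"
    and D D' :: "('f, 's) ham_parts"
    and \<rho> \<rho>' :: "real \<Rightarrow> complex^('f \<times> 's)^('f \<times> 's)"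
    and Y :: "complex^'f^'f" and Z :: "complex^'s^'s"
    and a b :: real
  assumes interval: "a < b"
    and unitary: "unitary_op Y" "unitary_op Z"
    and parts: "D' = conj_parts Y Z D"
    and state: "\<tau> \<in> {a..b} \<Longrightarrow> \<rho>' \<tau> = conjugate (Y \<otimes>\<^sub>o Z) (\<rho> \<tau>)"
    and effective: "\<tau> \<in> {a..b} \<Longrightarrow> R D' (\<rho>' \<tau>) = conj_parts Y Z (R D (\<rho> \<tau>))"
    and differentiable: "\<tau> \<in> {a..b} \<Longrightarrow> \<rho> differentiable (at \<tau> within {a..b})"
begin

lemma reduced_states:
  assumes "\<tau> \<in> {a..b}"
  shows "trace_frame (\<rho>' \<tau>) = conjugate Z (trace_frame (\<rho> \<tau>))"
    and "trace_sys (\<rho>' \<tau>) = conjugate Y (trace_sys (\<rho> \<tau>))"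
  using assms unitary by (simp_all add: state trace_frame_conjugate trace_sys_conjugate)

lemma effective_parts:
  assumes "\<tau> \<in> {a..b}"
  shows "sys_part (R D' (\<rho>' \<tau>)) = conjugate Z (sys_part (R D (\<rho> \<tau>)))"
    and "frame_part (R D' (\<rho>' \<tau>)) = conjugate Y (frame_part (R D (\<rho> \<tau>)))"
  using assms by (simp_all add: effective conj_parts_def)

context
  fixes t
  assumes t: "t \<in> {a..b}"
begin

text \<open>Both factors under the trace change by the same conjugation: the effective Hamiltonian
  by covariance, the state derivative because \<open>Z\<close> is constant in time.\<close>

lemma q_rate_sys_eq: "q_rate_sys R D' \<rho>' {a..b} t = q_rate_sys R D \<rho> {a..b} t"
  using vector_derivative_conjugate [OF interval t differentiable_linear_compose
      [OF linear_trace_frame differentiable [OF t]] reduced_states(1)]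
  by (simp add: q_rate_sys_def effective_parts [OF t] conjugate_mult trace_conjugate unitary)

lemma q_rate_frame_eq: "q_rate_frame R D' \<rho>' {a..b} t = q_rate_frame R D \<rho> {a..b} t"
  using vector_derivative_conjugate [OF interval t differentiable_linear_compose
      [OF linear_trace_sys differentiable [OF t]] reduced_states(2)]
  by (simp add: q_rate_frame_def effective_parts [OF t] conjugate_mult trace_conjugate unitary)

lemma E_rate_sys_eq: "E_rate_sys R D' \<rho>' {a..b} t = E_rate_sys R D \<rho> {a..b} t"
proof -
  have "sys_part D' + induced_sys D' (\<rho>' t) = conjugate Z (sys_part D + induced_sys D (\<rho> t))"
    using t unitary by (simp add: parts state induced_sys_conj conjugate_add)
      \<comment> \<open>\<open>conj_parts\<close> is unfolded only now, since
        \<open>induced_sys_conj\<close> matches its folded form.\<close>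
      (simp add: conj_parts_def)
  then show ?thesis
    using t unitary by (simp add: E_rate_sys_def effective_parts reduced_states
        conjugate_commutator conjugate_mult trace_conjugate)
qed

lemma E_rate_frame_eq: "E_rate_frame R D' \<rho>' {a..b} t = E_rate_frame R D \<rho> {a..b} t"
proof -
  have "frame_part D' + induced_frame D' (\<rho>' t)
      = conjugate Y (frame_part D + induced_frame D (\<rho> t))"
    using t unitary by (simp add: parts state induced_frame_conj conjugate_add)
      (simp add: conj_parts_def)
  then show ?thesis
    using t unitary by (simp add: E_rate_frame_def effective_parts reduced_states
        conjugate_commutator conjugate_mult trace_conjugate)
qed

lemma w_sys_defined_iff: "w_sys_defined R D' \<rho>' {a..b} t \<longleftrightarrow> w_sys_defined R D \<rho> {a..b} t"
  unfolding w_sys_defined_def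
  using unitary(2) t effective_parts(1) by (rule differentiable_conjugate_iff)

lemma w_frame_defined_iff:
  "w_frame_defined R D' \<rho>' {a..b} t \<longleftrightarrow> w_frame_defined R D \<rho> {a..b} t"
  unfolding w_frame_defined_def
  using unitary(1) t effective_parts(2) by (rule differentiable_conjugate_iff)

text \<open>Here the derivative falls on the effective Hamiltonian, whose differentiability does not
  follow from that of \<open>\<rho>\<close> and is therefore assumed.\<close>

lemma w_rate_sys_eq:
  assumes "w_sys_defined R D \<rho> {a..b} t"
  shows "w_rate_sys R D' \<rho>' {a..b} t = w_rate_sys R D \<rho> {a..b} t"
  using vector_derivative_conjugate [OF interval t assms [unfolded w_sys_defined_def]
      effective_parts(1)]
  by (simp add: w_rate_sys_def reduced_states [OF t] conjugate_mult trace_conjugate unitary)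

lemma w_rate_frame_eq:
  assumes "w_frame_defined R D \<rho> {a..b} t"
  shows "w_rate_frame R D' \<rho>' {a..b} t = w_rate_frame R D \<rho> {a..b} t"
  using vector_derivative_conjugate [OF interval t assms [unfolded w_frame_defined_def]
      effective_parts(2)]
  by (simp add: w_rate_frame_def reduced_states [OF t] conjugate_mult trace_conjugate unitary)

end

end

text \<open>Covariance is guaranteed on physical inputs, hence the premises on \<open>D\<close> and
  \<open>\<rho>\<close>.\<close>

lemma permissible_covariant:
  "permissible R \<Longrightarrow> unitary_op Y \<Longrightarrow> unitary_op Z \<Longrightarrow> bare_contributions D \<Longrightarrow>
     density_op \<rho> \<Longrightarrow>
     R (conj_parts Y Z D) (conjugate (Y \<otimes>\<^sub>o Z) \<rho>) = conj_parts Y Z (R D \<rho>)"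
  unfolding permissible_def agrees_on_physical_def by blast


section \<open>The frame swap\<close>

text \<open>Resolution of the identity in the group basis; both frames share one index type.\<close>

lemma relabel_frame_eq [simp]: "relabel_frame = mat 1"
proof -
  have "(\<Sum>g\<in>UNIV. if i = g \<and> j = g then 1 else 0) = (if i = j then 1 else (0::complex))"
    for i j :: 'a
    by (cases "i = j") (auto intro: sum.neutral)
  then show ?thesis
    by (simp add: relabel_frame_def ketbra_def mat_def vec_eq_iff)
qed

lemma frame_swap_eq [simp]: "frame_swap = mat 1"
  by (simp add: frame_swap_def)

lemma imported_parts_eq: "imported_parts Y Z D = conj_parts Y Z D"
  by (simp add: imported_parts_def conj_parts_def)

lemma imported_ham_eq: "imported_ham Y Z H = conjugate (Y \<otimes>\<^sub>o Z) H"
  by (simp add: imported_ham_def)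

theorem lemma12:
  fixes U :: "'g::{ab_group_add,finite} \<Rightarrow> complex^'s^'s"
    and gi gj :: 'g
    and Y :: "complex^('g::{ab_group_add,finite})^('g::{ab_group_add,finite})" and Z :: "complex^'s^'s"
    and H :: "complex^('g \<times> 's)^('g \<times> 's)"
    and Dj :: "('g, 's) ham_parts"
    and \<rho> :: "real \<Rightarrow> complex^('g \<times> 's)^('g \<times> 's)"
    and t0 t1 :: real
    and R :: "('g, 's) prescription"
  assumes "CARD('g) > 1"
    and "unitary_rep U"
    and "unitary_op Y" and "unitary_op Z"
    and "hermitian H"
    and "t0 < t1"
    and "\<forall>t\<in>{t0..t1}. density_op (\<rho> t)"
    and "von_neumann_solution H \<rho> {t0..t1}"
    and "\<forall>t\<in>{t0..t1}. \<rho> t \<in> TPS_invariant_algebra U gi gj Y Z"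
    and "bare_contributions_of (conjugate (frame_change U gi gj) H) Dj"
    and "permissible R"
  shows "let \<rho>j = (\<lambda>t. conjugate (frame_change U gi gj) (\<rho> t));
             Dji = imported_parts Y Z Dj;
             T = {t0..t1}
         in bare_contributions_of
              (imported_ham Y Z (conjugate (frame_change U gi gj) H)) Dji \<and>
            (\<forall>t\<in>T.
              q_rate_sys R Dj \<rho>j T t = q_rate_sys R Dji \<rho> T t \<and>
              E_rate_sys R Dj \<rho>j T t = E_rate_sys R Dji \<rho> T t \<and>
              Q_rate_sys R Dj \<rho>j T t = Q_rate_sys R Dji \<rho> T t \<and>
              (w_sys_defined R Dj \<rho>j T t \<longleftrightarrow> w_sys_defined R Dji \<rho> T t) \<and>
              (w_sys_defined R Dji \<rho> T t \<longrightarrow>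
                 w_rate_sys R Dj \<rho>j T t = w_rate_sys R Dji \<rho> T t \<and>
                 W_rate_sys R Dj \<rho>j T t = W_rate_sys R Dji \<rho> T t) \<and>
              q_rate_frame R Dj \<rho>j T t = q_rate_frame R Dji \<rho> T t \<and>
              E_rate_frame R Dj \<rho>j T t = E_rate_frame R Dji \<rho> T t \<and>
              Q_rate_frame R Dj \<rho>j T t = Q_rate_frame R Dji \<rho> T t \<and>
              (w_frame_defined R Dj \<rho>j T t \<longleftrightarrow> w_frame_defined R Dji \<rho> T t) \<and>
              (w_frame_defined R Dji \<rho> T t \<longrightarrow>
                 w_rate_frame R Dj \<rho>j T t = w_rate_frame R Dji \<rho> T t \<and>
                 W_rate_frame R Dj \<rho>j T t = W_rate_frame R Dji \<rho> T t))"
proof -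
  let ?\<rho>j = "\<lambda>t. conjugate (frame_change U gi gj) (\<rho> t)"
  let ?Dji = "imported_parts Y Z Dj"
  have bare: "bare_contributions_of
      (imported_ham Y Z (conjugate (frame_change U gi gj) H)) ?Dji"
    using assms(3,4,10)
    by (simp add: imported_ham_eq imported_parts_eq bare_contributions_of_conj_parts)
  \<comment> \<open>The import is read backwards: the imported data will be the unprimed ones, so
    the adjoints lead to the perspective of \<open>R_j\<close>.\<close>
  have Dj: "Dj = conj_parts (dagger Y) (dagger Z) ?Dji"
    using assms(3,4) by (simp add: imported_parts_eq conj_parts_dagger_cancel)
  \<comment> \<open>With a trivial swap this is TPS invariance itself. It concerns the states only;
    the Hamiltonian need not be invariant, which is why the imported one is compared.\<close>
  have \<rho>j: "?\<rho>j \<tau> = conjugate (dagger Y \<otimes>\<^sub>o dagger Z) (\<rho> \<tau>)" if "\<tau> \<in> {t0..t1}" for \<tau>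
    using assms(9) that by (simp add: TPS_invariant_algebra_def dagger_tensor_op)
  \<comment> \<open>Covariance is applied at the imported parts, whose bareness comes from
    \<open>bare\<close>, and at the density operator \<open>\<rho> \<tau>\<close>.\<close>
  have R: "R Dj (?\<rho>j \<tau>) = conj_parts (dagger Y) (dagger Z) (R ?Dji (\<rho> \<tau>))"
    if "\<tau> \<in> {t0..t1}" for \<tau>
    using permissible_covariant [of R "dagger Y" "dagger Z" ?Dji "\<rho> \<tau>"] assms(3,4,7,11) bare that
    by (simp add: \<rho>j unitary_op_dagger bare_contributions_of_def flip: Dj)
  interpret covariant_trajectory R ?Dji Dj \<rho> ?\<rho>j "dagger Y" "dagger Z" t0 t1
    using assms(3,4,6,8) Dj \<rho>j R
    by unfold_locales
       (auto intro: unitary_op_dagger von_neumann_solution_differentiable)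
  show ?thesis
    using bare
    by (simp add: Let_def q_rate_sys_eq q_rate_frame_eq E_rate_sys_eq E_rate_frame_eq
        w_sys_defined_iff w_frame_defined_iff w_rate_sys_eq w_rate_frame_eq
        W_rate_sys_def W_rate_frame_def Q_rate_sys_def Q_rate_frame_def)
qed

end
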